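(* Let $R$ be an associative ring with $1$ and let $\sigma$ be an essentially idempotent preradical over $R$-Mod. Then the class $\mathbb{F}_\sigma=\{M\mid\sigma(M)=0\}$ is closed under extensions.
   Context: $R$-Mod is the category of unitary left $R$-modules. A preradical over $R$-Mod is a subfunctor of the identity functor. For a preradical $\sigma$, $\widehat{\sigma}$ denotes the greatest idempotent preradical below $\sigma$ (pointwise order; idempotent means $\sigma(\sigma(M))=\sigma(M)$ for all $M$); explicitly $\widehat{\sigma}(M)=\sum\{N\leq M\mid\sigma(N)=N\}$. A preradical $\sigma$ is essentially idempotent if, for every left $R$-module $M$, $\sigma(M)\neq0$ implies $\widehat{\sigma}(M)\neq0$. A class $\mathcal{C}$ of modules is closed under extensions if for every short exact sequence $0\to M'\to M\to M''\to0$ with $M',M''\in\mathcal{C}$ one has $M\in\mathcal{C}$. *)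

theory Defs
  imports "HOL-Algebra.Algebra"
begin

(* The locale "module" requires a commutative ring of scalars; these are its
   axioms with the commutativity dropped (see left_module_iff_module).  As there, the
   ring-multiplication fields of the record M are not used. *)
locale left_module = R?: ring R + M?: abelian_group M
  for R :: "('r, 'z) ring_scheme" (structure) and M :: "('r, 'm) module" (structure) +
  assumes smult_closed [simp, intro]:
      "\<lbrakk>a \<in> carrier R; x \<in> carrier M\<rbrakk> \<Longrightarrow> a \<odot>\<^bsub>M\<^esub> x \<in> carrier M"
    and smult_l_distr:
      "\<lbrakk>a \<in> carrier R; b \<in> carrier R; x \<in> carrier M\<rbrakk> \<Longrightarrow>
      (a \<oplus>\<^bsub>R\<^esub> b) \<odot>\<^bsub>M\<^esub> x = a \<odot>\<^bsub>M\<^esub> x \<oplus>\<^bsub>M\<^esub> b \<odot>\<^bsub>M\<^esub> x"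
    and smult_r_distr:
      "\<lbrakk>a \<in> carrier R; x \<in> carrier M; y \<in> carrier M\<rbrakk> \<Longrightarrow>
      a \<odot>\<^bsub>M\<^esub> (x \<oplus>\<^bsub>M\<^esub> y) = a \<odot>\<^bsub>M\<^esub> x \<oplus>\<^bsub>M\<^esub> a \<odot>\<^bsub>M\<^esub> y"
    and smult_assoc1:
      "\<lbrakk>a \<in> carrier R; b \<in> carrier R; x \<in> carrier M\<rbrakk> \<Longrightarrow>
      (a \<otimes>\<^bsub>R\<^esub> b) \<odot>\<^bsub>M\<^esub> x = a \<odot>\<^bsub>M\<^esub> (b \<odot>\<^bsub>M\<^esub> x)"
    and smult_one [simp]:
      "x \<in> carrier M \<Longrightarrow> \<one>\<^bsub>R\<^esub> \<odot>\<^bsub>M\<^esub> x = x"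

lemma left_module_iff_module:
  assumes "cring R"
  shows "left_module R M \<longleftrightarrow> module R M"
  using assms cring.axioms(1)[OF assms]
  by (simp add: left_module_def module_def left_module_axioms_def module_axioms_def)

definition left_module_hom ::
  "('r, 'z) ring_scheme \<Rightarrow> ('r, 'm) module \<Rightarrow> ('r, 'm) module \<Rightarrow> ('m \<Rightarrow> 'm) set" where
  "left_module_hom R M N =
     {f \<in> hom (add_monoid M) (add_monoid N).
        \<forall>a\<in>carrier R. \<forall>x\<in>carrier M. f (a \<odot>\<^bsub>M\<^esub> x) = a \<odot>\<^bsub>N\<^esub> f x}"

definition submod :: "('r, 'm) module \<Rightarrow> 'm set \<Rightarrow> ('r, 'm) module" where
  "submod M N = M\<lparr>carrier := N\<rparr>"

(* R-Mod is the category of all left R-modules with carrier in an arbitrary type 'm.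
   A subfunctor of the identity is given by its values, as subsets of the carriers; its
   action on a morphism is the restriction.  Values on records that are not left modules
   are irrelevant. *)
definition preradical ::
  "('r, 'z) ring_scheme \<Rightarrow> (('r, 'm) module \<Rightarrow> 'm set) \<Rightarrow> bool" where
  "preradical R \<sigma> \<longleftrightarrow>
     (\<forall>M. left_module R M \<longrightarrow> submodule (\<sigma> M) R M) \<and>
     (\<forall>M N f. left_module R M \<longrightarrow> left_module R N \<longrightarrow> f \<in> left_module_hom R M N \<longrightarrow>
        f ` \<sigma> M \<subseteq> \<sigma> N)"

definition preradical_le ::
  "('r, 'z) ring_scheme \<Rightarrow> (('r, 'm) module \<Rightarrow> 'm set) \<Rightarrow> (('r, 'm) module \<Rightarrow> 'm set) \<Rightarrow> bool" where
  "preradical_le R \<tau> \<sigma> \<longleftrightarrow> (\<forall>M. left_module R M \<longrightarrow> \<tau> M \<subseteq> \<sigma> M)"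

definition idempotent_preradical ::
  "('r, 'z) ring_scheme \<Rightarrow> (('r, 'm) module \<Rightarrow> 'm set) \<Rightarrow> bool" where
  "idempotent_preradical R \<sigma> \<longleftrightarrow>
     preradical R \<sigma> \<and> (\<forall>M. left_module R M \<longrightarrow> \<sigma> (submod M (\<sigma> M)) = \<sigma> M)"

(* The sum of a family of submodules is the additive subgroup generated by their union.
   That this is the greatest idempotent preradical below \<sigma> is shown in
   idempotent_core_greatest. *)
definition idempotent_core ::
  "('r, 'z) ring_scheme \<Rightarrow> (('r, 'm) module \<Rightarrow> 'm set) \<Rightarrow> ('r, 'm) module \<Rightarrow> 'm set" where
  "idempotent_core R \<sigma> M =
     generate (add_monoid M) (\<Union> {N. submodule N R M \<and> \<sigma> (submod M N) = N})"

definition essentially_idempotent ::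
  "('r, 'z) ring_scheme \<Rightarrow> (('r, 'm) module \<Rightarrow> 'm set) \<Rightarrow> bool" where
  "essentially_idempotent R \<sigma> \<longleftrightarrow>
     (\<forall>M. left_module R M \<longrightarrow> \<sigma> M \<noteq> {\<zero>\<^bsub>M\<^esub>} \<longrightarrow> idempotent_core R \<sigma> M \<noteq> {\<zero>\<^bsub>M\<^esub>})"

definition torsion_free_class ::
  "('r, 'z) ring_scheme \<Rightarrow> (('r, 'm) module \<Rightarrow> 'm set) \<Rightarrow> ('r, 'm) module set" where
  "torsion_free_class R \<sigma> = {M. left_module R M \<and> \<sigma> M = {\<zero>\<^bsub>M\<^esub>}}"

definition short_exact ::
  "('r, 'z) ring_scheme \<Rightarrow> ('r, 'm) module \<Rightarrow> ('m \<Rightarrow> 'm) \<Rightarrow> ('r, 'm) module \<Rightarrow> ('m \<Rightarrow> 'm) \<Rightarrow>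
   ('r, 'm) module \<Rightarrow> bool" where
  "short_exact R M' f M g M'' \<longleftrightarrow>
     left_module R M' \<and> left_module R M \<and> left_module R M'' \<and>
     f \<in> left_module_hom R M' M \<and> g \<in> left_module_hom R M M'' \<and>
     inj_on f (carrier M') \<and> f ` carrier M' = a_kernel M M'' g \<and> g ` carrier M = carrier M''"

definition closed_under_extensions ::
  "('r, 'z) ring_scheme \<Rightarrow> ('r, 'm) module set \<Rightarrow> bool" where
  "closed_under_extensions R \<C> \<longleftrightarrow>
     (\<forall>M' M M'' f g. short_exact R M' f M g M'' \<longrightarrow> M' \<in> \<C> \<longrightarrow> M'' \<in> \<C> \<longrightarrow> M \<in> \<C>)"

lemma submod_simps [simp]:
  "carrier (submod M N) = N" "ring.add (submod M N) = ring.add M" "ring.zero (submod M N) = ring.zero M"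
  "smult (submod M N) = smult M"
  by (simp_all add: submod_def)

lemma add_monoid_submod: "add_monoid (submod M N) = (add_monoid M)\<lparr>carrier := N\<rparr>"
  by (simp add: submod_def)

context left_module
begin

lemma submodule_subset: "submodule N R M \<Longrightarrow> N \<subseteq> carrier M"
  using subgroup.subset[of N "add_monoid M"] by (simp add: submodule_def)

lemma left_module_submod:
  assumes "submodule N R M"
  shows "left_module R (submod M N)"
proof -
  interpret N: submodule N R M by fact
  have sub: "N \<subseteq> carrier M" using submodule_subset[OF assms] .
  have "comm_monoid ((add_monoid M)\<lparr>carrier := N\<rparr>)"
    using comm_monoid.submonoid_is_comm_monoid[OF M.a_comm_monoid]
      N.subgroup_is_submonoid by blast
  moreover have "group ((add_monoid M)\<lparr>carrier := N\<rparr>)"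
    using N.subgroup_is_group[OF M.a_group] .
  ultimately have "abelian_group (submod M N)"
    unfolding abelian_group_def abelian_group_axioms_def abelian_monoid_def
      add_monoid_submod comm_group_def by simp
  then show ?thesis
    unfolding left_module_def left_module_axioms_def
    using sub R.ring_axioms
    by (auto simp: subset_iff smult_l_distr smult_r_distr smult_assoc1)
qed

lemma submodule_in_submod:
  assumes "submodule N R M" "submodule K R M" "K \<subseteq> N"
  shows "submodule K R (submod M N)"
proof -
  have "subgroup K ((add_monoid M)\<lparr>carrier := N\<rparr>)"
    using assms M.add.subgroup_incl unfolding submodule_def by blast
  then show ?thesis
    using assms(2) unfolding submodule_def submodule_axioms_def add_monoid_submod by simp
qed

lemma submodule_trans:
  assumes "submodule N R M" "submodule K R (submod M N)"
  shows "submodule K R M"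
proof -
  have "subgroup K (add_monoid M)"
    using assms M.add.incl_subgroup unfolding submodule_def add_monoid_submod by blast
  then show ?thesis
    using assms(2) unfolding submodule_def submodule_axioms_def by simp
qed

lemma submod_incl_hom:
  assumes "submodule N R M"
  shows "id \<in> left_module_hom R (submod M N) M"
  using submodule_subset[OF assms] by (auto simp: left_module_hom_def hom_def)

lemma submodule_image:
  assumes L: "left_module R L" and f: "f \<in> left_module_hom R M L" and N: "submodule N R M"
  shows "submodule (f ` N) R L"
proof -
  interpret L: left_module R L by fact
  interpret group_hom "add_monoid M" "add_monoid L" f
    using f M.a_group L.a_group unfolding group_hom_def group_hom_axioms_def left_module_hom_def
    by simp
  have "subgroup (f ` N) (add_monoid L)"
    using N subgroup_img_is_subgroup unfolding submodule_def by blast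
  moreover have "a \<odot>\<^bsub>L\<^esub> f x \<in> f ` N" if "a \<in> carrier R" "x \<in> N" for a x
  proof -
    have "a \<odot>\<^bsub>L\<^esub> f x = f (a \<odot>\<^bsub>M\<^esub> x)"
      using that f submodule_subset[OF N] by (auto simp: left_module_hom_def)
    then show ?thesis using submodule.smult_closed[OF N that] by simp
  qed
  ultimately show ?thesis unfolding submodule_def submodule_axioms_def by blast
qed

end

lemma submodule_idempotent_core:
  fixes M :: "('r, 'm) module"
  assumes M: "left_module R M"
  shows "submodule (idempotent_core R \<sigma> M) R M"
proof -
  interpret left_module R M by fact
  let ?U = "\<Union> {N. submodule N R M \<and> \<sigma> (submod M N) = N}"
  have U: "?U \<subseteq> carrier M" using submodule_subset by blast
  have sg: "subgroup (generate (add_monoid M) ?U) (add_monoid M)"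
    using M.add.generate_is_subgroup U by simp
  have "a \<odot>\<^bsub>M\<^esub> x \<in> generate (add_monoid M) ?U"
    if a: "a \<in> carrier R" and x: "x \<in> generate (add_monoid M) ?U" for a x
    using x
  proof (induction x rule: generate.induct)
    case one
    have "a \<odot>\<^bsub>M\<^esub> \<zero>\<^bsub>M\<^esub> \<oplus>\<^bsub>M\<^esub> a \<odot>\<^bsub>M\<^esub> \<zero>\<^bsub>M\<^esub> = a \<odot>\<^bsub>M\<^esub> \<zero>\<^bsub>M\<^esub>"
      using a smult_r_distr[of a "\<zero>\<^bsub>M\<^esub>" "\<zero>\<^bsub>M\<^esub>"] by simp
    then have "a \<odot>\<^bsub>M\<^esub> \<zero>\<^bsub>M\<^esub> = \<zero>\<^bsub>M\<^esub>"
      using a M.add.r_cancel_one' by fastforce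
    then show ?case using generate.one[of "add_monoid M" ?U] by simp
  next
    case (incl h)
    then obtain N where N: "submodule N R M" "\<sigma> (submod M N) = N" "h \<in> N" by blast
    then have "a \<odot>\<^bsub>M\<^esub> h \<in> N" using submodule.smult_closed[OF N(1) a] by blast
    then show ?case using N by (intro generate.incl) blast
  next
    case (inv h)
    then obtain N where N: "submodule N R M" "\<sigma> (submod M N) = N" "h \<in> N" by blast
    then have "inv\<^bsub>add_monoid M\<^esub> h \<in> N"
      using subgroup.m_inv_closed[of N "add_monoid M" h] by (simp add: submodule_def)
    then have "a \<odot>\<^bsub>M\<^esub> (inv\<^bsub>add_monoid M\<^esub> h) \<in> N"
      using submodule.smult_closed[OF N(1) a] by blast
    then show ?case using N by (intro generate.incl) blast
  next
    case (eng h1 h2)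
    have "h1 \<in> carrier M" "h2 \<in> carrier M"
      using eng.hyps subgroup.subset[OF sg] by auto
    then have "a \<odot>\<^bsub>M\<^esub> (h1 \<otimes>\<^bsub>add_monoid M\<^esub> h2)
        = (a \<odot>\<^bsub>M\<^esub> h1) \<otimes>\<^bsub>add_monoid M\<^esub> (a \<odot>\<^bsub>M\<^esub> h2)"
      using a smult_r_distr by simp
    then show ?case using generate.eng[OF eng.IH] by simp
  qed
  then show ?thesis
    using sg unfolding idempotent_core_def submodule_def submodule_axioms_def by blast
qed

lemma idempotent_core_upper:
  assumes "submodule N R M" "\<sigma> (submod M N) = N"
  shows "N \<subseteq> idempotent_core R \<sigma> M"
proof
  fix x assume "x \<in> N"
  then show "x \<in> idempotent_core R \<sigma> M"
    unfolding idempotent_core_def by (intro generate.incl) (use assms in blast)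
qed

lemma idempotent_core_least:
  fixes M :: "('r, 'm) module"
  assumes M: "left_module R M" and H: "subgroup H (add_monoid M)"
    and "\<And>N. submodule N R M \<Longrightarrow> \<sigma> (submod M N) = N \<Longrightarrow> N \<subseteq> H"
  shows "idempotent_core R \<sigma> M \<subseteq> H"
proof -
  interpret left_module R M by fact
  show ?thesis unfolding idempotent_core_def
    by (rule M.add.generate_subgroup_incl[OF _ H]) (use assms(3) in blast)
qed

lemma preradical_idempotent_core:
  fixes \<sigma> :: "('r, 'm) module \<Rightarrow> 'm set"
  assumes \<sigma>: "preradical R \<sigma>"
  shows "preradical R (idempotent_core R \<sigma>)"
  unfolding preradical_def
proof (intro conjI allI impI)
  fix M :: "('r, 'm) module" assume "left_module R M"
  then show "submodule (idempotent_core R \<sigma> M) R M" by (rule submodule_idempotent_core)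
next
  fix M L :: "('r, 'm) module" and f
  assume M: "left_module R M" and L: "left_module R L" and f: "f \<in> left_module_hom R M L"
  interpret M: left_module R M by fact
  interpret L: left_module R L by fact
  interpret fh: group_hom "add_monoid M" "add_monoid L" f
    using f M.M.a_group L.M.a_group
    unfolding group_hom_def group_hom_axioms_def left_module_hom_def by simp
  let ?C = "idempotent_core R \<sigma> L"
  let ?H = "{x \<in> carrier M. f x \<in> ?C}"
  have C: "subgroup ?C (add_monoid L)"
    using submodule_idempotent_core[OF L] unfolding submodule_def by blast
  have H: "subgroup ?H (add_monoid M)"
  proof (rule group.subgroupI[OF M.M.a_group])
    show "?H \<noteq> {}" using subgroup.one_closed[OF C] fh.hom_one M.M.zero_closed by fastforce
  next
    fix x assume "x \<in> ?H"
    then show "inv\<^bsub>add_monoid M\<^esub> x \<in> ?H"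
      using subgroup.m_inv_closed[OF C] fh.hom_inv[of x] M.M.add.inv_closed[of x] by simp
  next
    fix x y assume "x \<in> ?H" "y \<in> ?H"
    then show "x \<otimes>\<^bsub>add_monoid M\<^esub> y \<in> ?H"
      using subgroup.m_closed[OF C] fh.hom_mult[of x y] by simp
  qed auto
  have "idempotent_core R \<sigma> M \<subseteq> ?H"
  proof (rule idempotent_core_least[OF M H])
    fix N assume N: "submodule N R M" "\<sigma> (submod M N) = N"
    have fN: "submodule (f ` N) R L" using M.submodule_image[OF L f N(1)] .
    have mN: "left_module R (submod M N)" using M.left_module_submod[OF N(1)] .
    have mfN: "left_module R (submod L (f ` N))" using L.left_module_submod[OF fN] .
    have "f \<in> left_module_hom R (submod M N) (submod L (f ` N))"
      using f M.submodule_subset[OF N(1)] by (auto simp: left_module_hom_def hom_def subset_iff)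
    then have "f ` \<sigma> (submod M N) \<subseteq> \<sigma> (submod L (f ` N))"
      using \<sigma> mN mfN unfolding preradical_def by blast
    moreover have "\<sigma> (submod L (f ` N)) \<subseteq> f ` N"
      using \<sigma> mfN left_module.submodule_subset[OF mfN] unfolding preradical_def by simp
    ultimately have "\<sigma> (submod L (f ` N)) = f ` N" using N(2) by auto
    then have "f ` N \<subseteq> ?C" by (rule idempotent_core_upper[OF fN])
    then show "N \<subseteq> ?H" using M.submodule_subset[OF N(1)] by blast
  qed
  then show "f ` idempotent_core R \<sigma> M \<subseteq> ?C" by blast
qed

theorem idempotent_core_greatest:
  fixes \<sigma> :: "('r, 'm) module \<Rightarrow> 'm set"
  assumes \<sigma>: "preradical R \<sigma>"
  shows "idempotent_preradical R (idempotent_core R \<sigma>)"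
    and "preradical_le R (idempotent_core R \<sigma>) \<sigma>"
    and "\<And>\<tau>. idempotent_preradical R \<tau> \<Longrightarrow> preradical_le R \<tau> \<sigma> \<Longrightarrow>
           preradical_le R \<tau> (idempotent_core R \<sigma>)"
proof -
  have "idempotent_core R \<sigma> (submod M (idempotent_core R \<sigma> M)) = idempotent_core R \<sigma> M"
    if M: "left_module R M" for M
  proof -
    interpret left_module R M by fact
    let ?C = "idempotent_core R \<sigma> M"
    let ?D = "idempotent_core R \<sigma> (submod M ?C)"
    have C: "submodule ?C R M" using submodule_idempotent_core[OF M] .
    have mC: "left_module R (submod M ?C)" using left_module_submod[OF C] .
    have D: "submodule ?D R (submod M ?C)" using submodule_idempotent_core[OF mC] .
    have "subgroup ?D (add_monoid M)"
      using submodule_trans[OF C D] unfolding submodule_def by blast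
    then have "?C \<subseteq> ?D"
    proof (rule idempotent_core_least[OF M])
      fix N assume N: "submodule N R M" "\<sigma> (submod M N) = N"
      have "submodule N R (submod M ?C)"
        using submodule_in_submod[OF C N(1) idempotent_core_upper[of N R M \<sigma>]] N by blast
      moreover have "\<sigma> (submod (submod M ?C) N) = N" using N(2) by (simp add: submod_def)
      ultimately show "N \<subseteq> ?D" by (rule idempotent_core_upper)
    qed
    moreover have "?D \<subseteq> ?C" using left_module.submodule_subset[OF mC D] by simp
    ultimately show ?thesis by blast
  qed
  then show "idempotent_preradical R (idempotent_core R \<sigma>)"
    using preradical_idempotent_core[OF \<sigma>] unfolding idempotent_preradical_def by blast
  show "preradical_le R (idempotent_core R \<sigma>) \<sigma>"
    unfolding preradical_le_def
  proof (intro allI impI)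
    fix M :: "('r, 'm) module" assume M: "left_module R M"
    interpret left_module R M by fact
    have "subgroup (\<sigma> M) (add_monoid M)"
      using \<sigma> M unfolding preradical_def submodule_def by blast
    then show "idempotent_core R \<sigma> M \<subseteq> \<sigma> M"
    proof (rule idempotent_core_least[OF M])
      fix N assume N: "submodule N R M" "\<sigma> (submod M N) = N"
      have "id ` \<sigma> (submod M N) \<subseteq> \<sigma> M"
        using \<sigma> M left_module_submod[OF N(1)] submod_incl_hom[OF N(1)]
        unfolding preradical_def by blast
      then show "N \<subseteq> \<sigma> M" using N(2) by simp
    qed
  qed
  fix \<tau> :: "('r, 'm) module \<Rightarrow> 'm set"
  assume \<tau>: "idempotent_preradical R \<tau>" and le: "preradical_le R \<tau> \<sigma>"
  show "preradical_le R \<tau> (idempotent_core R \<sigma>)"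
    unfolding preradical_le_def
  proof (intro allI impI)
    fix M :: "('r, 'm) module" assume M: "left_module R M"
    interpret left_module R M by fact
    have N: "submodule (\<tau> M) R M"
      using \<tau> M unfolding idempotent_preradical_def preradical_def by blast
    have mN: "left_module R (submod M (\<tau> M))" using left_module_submod[OF N] .
    have "\<tau> M \<subseteq> \<sigma> (submod M (\<tau> M))"
      using \<tau> le M mN unfolding idempotent_preradical_def preradical_le_def by blast
    moreover have "\<sigma> (submod M (\<tau> M)) \<subseteq> \<tau> M"
      using \<sigma> mN left_module.submodule_subset[OF mN] unfolding preradical_def by simp
    ultimately have "\<sigma> (submod M (\<tau> M)) = \<tau> M" by blast
    then show "\<tau> M \<subseteq> idempotent_core R \<sigma> M" by (rule idempotent_core_upper[OF N])
  qed
qed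

end

theory Submission
  imports Defs
begin

text \<open>
  Call a module \<open>N\<close> torsion when \<open>\<sigma> N = N\<close> and torsion-free when \<open>\<sigma> N = 0\<close>. By functoriality the
  only homomorphism from a torsion module to a torsion-free one is zero
  (\<open>hom_torsion_torsion_free\<close>). Let \<open>M\<close> be an extension of \<open>M''\<close> by \<open>M'\<close>, both torsion-free, and let
  \<open>N\<close> be a torsion submodule of \<open>M\<close>. The projection to \<open>M''\<close> kills \<open>N\<close>, so \<open>N\<close> lies in the copy of
  \<open>M'\<close> inside \<open>M\<close>; being torsion, it maps to zero in \<open>M'\<close> as well, so \<open>N = 0\<close>
  (\<open>torsion_submodule_of_extension\<close>). Hence the idempotent core of \<open>M\<close>, the sum of its torsion
  submodules, vanishes, and essential idempotence then gives \<open>\<sigma> M = 0\<close>.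
\<close>

lemma hom_torsion_torsion_free:
  assumes \<sigma>: "preradical R \<sigma>" and N: "left_module R N" and L: "L \<in> torsion_free_class R \<sigma>"
    and torsion: "\<sigma> N = carrier N" and h: "h \<in> left_module_hom R N L" and x: "x \<in> carrier N"
  shows "h x = \<zero>\<^bsub>L\<^esub>"
proof -
  have "h ` \<sigma> N \<subseteq> \<sigma> L"
    using \<sigma> N L h unfolding preradical_def torsion_free_class_def by blast
  then show ?thesis
    using L torsion x unfolding torsion_free_class_def by blast
qed

lemma left_module_hom_submod:
  assumes "left_module R M" "submodule N R M" "g \<in> left_module_hom R M L"
  shows "g \<in> left_module_hom R (submod M N) L"
  using left_module.submodule_subset[OF assms(1,2)] assms(3)
  by (auto simp: left_module_hom_def hom_def subset_iff)

text \<open>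
  Pulls a submodule of the kernel of an extension back to the left-hand term, so that
  torsion-freeness of that term can be applied to it. Working with the inverse of the injection
  on \<open>N\<close> avoids comparing the values of \<open>\<sigma>\<close> on isomorphic modules.
\<close>
lemma left_module_hom_inv_into:
  assumes K: "left_module R K" and M: "left_module R M"
    and f: "f \<in> left_module_hom R K M" and inj: "inj_on f (carrier K)"
    and N: "submodule N R M" and sub: "N \<subseteq> f ` carrier K"
  shows "inv_into (carrier K) f \<in> left_module_hom R (submod M N) K"
proof -
  interpret K: left_module R K by fact
  let ?h = "inv_into (carrier K) f"
  have fadd: "f (x \<oplus>\<^bsub>K\<^esub> y) = f x \<oplus>\<^bsub>M\<^esub> f y" if "x \<in> carrier K" "y \<in> carrier K" for x y
    using f that by (simp add: left_module_hom_def hom_def)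
  have fsmult: "f (a \<odot>\<^bsub>K\<^esub> x) = a \<odot>\<^bsub>M\<^esub> f x" if "a \<in> carrier R" "x \<in> carrier K" for a x
    using f that by (simp add: left_module_hom_def)
  have h: "?h x \<in> carrier K" "f (?h x) = x" if "x \<in> N" for x
    using that sub inv_into_into[of x f "carrier K"] f_inv_into_f[of x f "carrier K"] by blast+
  have "?h (x \<oplus>\<^bsub>M\<^esub> y) = ?h x \<oplus>\<^bsub>K\<^esub> ?h y" if "x \<in> N" "y \<in> N" for x y
    using inv_into_f_eq[OF inj] fadd h that by simp
  moreover have "?h (a \<odot>\<^bsub>M\<^esub> x) = a \<odot>\<^bsub>K\<^esub> ?h x" if "a \<in> carrier R" "x \<in> N" for a x
    using inv_into_f_eq[OF inj] fsmult h that by simp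
  ultimately show ?thesis
    using h(1) by (auto simp: left_module_hom_def hom_def)
qed

text \<open>
  The vanishing of homomorphisms is used twice: for the projection restricted to \<open>N\<close>, which puts
  \<open>N\<close> into the kernel, and for the inverse of the injection, which is defined on \<open>N\<close> by then.
\<close>
lemma torsion_submodule_of_extension:
  assumes \<sigma>: "preradical R \<sigma>" and ex: "short_exact R M' f M g M''"
    and M': "M' \<in> torsion_free_class R \<sigma>" and M'': "M'' \<in> torsion_free_class R \<sigma>"
    and N: "submodule N R M" and torsion: "\<sigma> (submod M N) = N"
  shows "N \<subseteq> {\<zero>\<^bsub>M\<^esub>}"
proof
  fix x assume x: "x \<in> N"
  have mods: "left_module R M'" "left_module R M"
    and f: "f \<in> left_module_hom R M' M" and g: "g \<in> left_module_hom R M M''"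
    and inj: "inj_on f (carrier M')" and ker: "f ` carrier M' = a_kernel M M'' g"
    using ex unfolding short_exact_def by auto
  interpret M': left_module R M' by (fact mods)
  interpret M: left_module R M by (fact mods)
  interpret f: group_hom "add_monoid M'" "add_monoid M" f
    using f M'.M.a_group M.M.a_group
    unfolding group_hom_def group_hom_axioms_def left_module_hom_def by simp
  have mN: "left_module R (submod M N)" using M.left_module_submod[OF N] .
  have tN: "\<sigma> (submod M N) = carrier (submod M N)" using torsion by simp
  have "g y = \<zero>\<^bsub>M''\<^esub>" if "y \<in> N" for y
    using hom_torsion_torsion_free[OF \<sigma> mN M'' tN left_module_hom_submod[OF mods(2) N g]] that
    by simp
  then have sub: "N \<subseteq> f ` carrier M'"
    using M.submodule_subset[OF N] unfolding ker by (auto simp: a_kernel_def kernel_def)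
  have "inv_into (carrier M') f x = \<zero>\<^bsub>M'\<^esub>"
    using hom_torsion_torsion_free[OF \<sigma> mN M' tN
        left_module_hom_inv_into[OF mods f inj N sub]] x by simp
  then have "x = f \<zero>\<^bsub>M'\<^esub>" using f_inv_into_f[of x f "carrier M'"] x sub by auto
  then show "x \<in> {\<zero>\<^bsub>M\<^esub>}" using f.hom_one by simp
qed

theorem mainTheorem2:
  fixes R :: "('r, 'z) ring_scheme" and \<sigma> :: "('r, 'm) module \<Rightarrow> 'm set"
  assumes "ring R"
    and "preradical R \<sigma>"
    and "essentially_idempotent R \<sigma>"
  shows "closed_under_extensions R (torsion_free_class R \<sigma>)"
  unfolding closed_under_extensions_def
proof (intro allI impI)
  fix M' M M'' :: "('r, 'm) module" and f g
  assume ex: "short_exact R M' f M g M''"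
    and M': "M' \<in> torsion_free_class R \<sigma>" and M'': "M'' \<in> torsion_free_class R \<sigma>"
  have M: "left_module R M" using ex unfolding short_exact_def by blast
  interpret M: left_module R M by fact
  have "idempotent_core R \<sigma> M \<subseteq> {\<zero>\<^bsub>M\<^esub>}"
    using idempotent_core_least[OF M _ torsion_submodule_of_extension[OF assms(2) ex M' M'']]
      M.M.add.triv_subgroup by simp
  moreover have "\<zero>\<^bsub>M\<^esub> \<in> idempotent_core R \<sigma> M"
    using submodule_idempotent_core[OF M, of \<sigma>] subgroup.one_closed
    unfolding submodule_def by fastforce
  ultimately have "idempotent_core R \<sigma> M = {\<zero>\<^bsub>M\<^esub>}" by blast
  then have "\<sigma> M = {\<zero>\<^bsub>M\<^esub>}"
    using assms(3) M unfolding essentially_idempotent_def by blast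
  then show "M \<in> torsion_free_class R \<sigma>"
    using M unfolding torsion_free_class_def by blast
qed

end
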